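(* Let $m,n$ be integers with $3\leq m\leq n$. Then $$\chi_{lid}(C_m \square C_n)=\begin{cases}5 & \text{if } m=3,\\ 3 & \text{if } m \text{ and } n \text{ are both even},\\ 4 & \text{otherwise}.\end{cases}$$
   Context: $C_m$ denotes the cycle on $m$ vertices. A proper $k$-coloring of a graph $G$ is a map $f:V(G)\to\{1,\dots,k\}$ with $f(u)\neq f(v)$ for every edge $uv$. For a vertex $v$, $N[v]$ denotes its closed neighborhood, and $f(S)=\{f(x):x\in S\}$. A lid-coloring of $G$ is a proper coloring $f$ such that for every edge $uv$ with $N[u]\neq N[v]$ we have $f(N[u])\neq f(N[v])$; $\chi_{lid}(G)$ is the smallest number of colors in a lid-coloring of $G$. The Cartesian product $G\square H$ has vertex set $V(G)\times V(H)$, where $(u_1,v_1)$ and $(u_2,v_2)$ are adjacent iff either $u_1=u_2$ and $v_1v_2\in E(H)$, or $v_1=v_2$ and $u_1u_2\in E(G)$. *)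

theory Defs
  imports Main
begin

record 'a ugraph =
  verts :: "'a set"
  adj :: "'a \<Rightarrow> 'a \<Rightarrow> bool"

definition simple_graph :: "'a ugraph \<Rightarrow> bool" where
  "simple_graph G \<longleftrightarrow>
     (\<forall>u v. adj G u v \<longrightarrow> u \<in> verts G \<and> v \<in> verts G \<and> u \<noteq> v \<and> adj G v u)"

definition closed_nbhd :: "'a ugraph \<Rightarrow> 'a \<Rightarrow> 'a set" where
  "closed_nbhd G v = insert v {u. adj G v u}"

definition proper_coloring :: "'a ugraph \<Rightarrow> nat \<Rightarrow> ('a \<Rightarrow> nat) \<Rightarrow> bool" where
  "proper_coloring G k f \<longleftrightarrow>
     f ` verts G \<subseteq> {1..k} \<and> (\<forall>u v. adj G u v \<longrightarrow> f u \<noteq> f v)"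

definition lid_coloring :: "'a ugraph \<Rightarrow> nat \<Rightarrow> ('a \<Rightarrow> nat) \<Rightarrow> bool" where
  "lid_coloring G k f \<longleftrightarrow>
     proper_coloring G k f \<and>
     (\<forall>u v. adj G u v \<longrightarrow> closed_nbhd G u \<noteq> closed_nbhd G v \<longrightarrow>
        f ` closed_nbhd G u \<noteq> f ` closed_nbhd G v)"

text \<open>The minimum exists for every finite simple graph; see \<open>ex_lid_coloring\<close> below.\<close>

definition chi_lid :: "'a ugraph \<Rightarrow> nat" where
  "chi_lid G = (LEAST k. \<exists>f. lid_coloring G k f)"

text \<open>For \<^term>\<open>m \<ge> (3::nat)\<close> this is the cycle on \<open>m\<close> vertices, labelled \<open>0, \<dots>, m - 1\<close>.\<close>

definition cycle_graph :: "nat \<Rightarrow> nat ugraph" where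
  "cycle_graph m =
     \<lparr> verts = {..<m},
       adj = (\<lambda>i j. i < m \<and> j < m \<and> (j = (i + 1) mod m \<or> i = (j + 1) mod m)) \<rparr>"

definition cartesian_product :: "'a ugraph \<Rightarrow> 'b ugraph \<Rightarrow> ('a \<times> 'b) ugraph"
    (infixl "\<box>" 70) where
  "G \<box> H =
     \<lparr> verts = verts G \<times> verts H,
       adj = (\<lambda>(u\<^sub>1, v\<^sub>1) (u\<^sub>2, v\<^sub>2).
                (u\<^sub>1 \<in> verts G \<and> u\<^sub>1 = u\<^sub>2 \<and> adj H v\<^sub>1 v\<^sub>2) \<or>
                (v\<^sub>1 \<in> verts H \<and> v\<^sub>1 = v\<^sub>2 \<and> adj G u\<^sub>1 u\<^sub>2)) \<rparr>"

lemma simple_graph_cycle_graph: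
  assumes "m \<ge> 2"
  shows "simple_graph (cycle_graph m)"
proof -
  have "(i + 1) mod m \<noteq> i" if "i < m" for i
    using that assms by (cases "i + 1 = m") auto
  then show ?thesis
    by (force simp: simple_graph_def cycle_graph_def)
qed

lemma simple_graph_cartesian_product:
  assumes "simple_graph G" and "simple_graph H"
  shows "simple_graph (G \<box> H)"
  using assms unfolding simple_graph_def cartesian_product_def by auto

lemma ex_lid_coloring:
  assumes "simple_graph G" and "finite (verts G)"
  shows "\<exists>k f. lid_coloring G k f"
proof -
  obtain g where g: "bij_betw g (verts G) {0..<card (verts G)}"
    using assms(2) ex_bij_betw_finite_nat by blast
  define f where "f = (\<lambda>v. g v + 1)"
  have inj: "inj_on f (verts G)"
    using g by (auto simp: f_def bij_betw_def inj_on_def)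
  have range: "f ` verts G \<subseteq> {1..card (verts G)}"
    using bij_betwE[OF g] by (auto simp: f_def Suc_le_eq)
  have sub: "closed_nbhd G v \<subseteq> verts G" if "v \<in> verts G" for v
    using assms(1) that by (auto simp: closed_nbhd_def simple_graph_def)
  have "lid_coloring G (card (verts G)) f"
    unfolding lid_coloring_def proper_coloring_def
  proof (intro conjI allI impI)
    fix u v assume uv: "adj G u v"
    then have V: "u \<in> verts G" "v \<in> verts G" "u \<noteq> v"
      using assms(1) by (auto simp: simple_graph_def)
    show "f u \<noteq> f v"
      using V inj by (auto dest: inj_onD)
    show "f ` closed_nbhd G u \<noteq> f ` closed_nbhd G v"
      if "closed_nbhd G u \<noteq> closed_nbhd G v"
      using that V sub inj by (simp add: inj_on_image_eq_iff)
  qed (fact range)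
  then show ?thesis by blast
qed

end

theory Submission
  imports Defs
begin

text \<open>
  Two adjacent vertices have closed neighbourhoods whose colour sets both contain the two end
  colours. With three colours one of these sets must therefore have two elements and the other
  three, so the size of the colour set is a proper 2-colouring and both cycles are even. On a
  triangle all three colour sets contain the three colours of the triangle; being distinct, they
  need at least two further colours.

  For the upper bounds, a vertex \<open>i\<close> of a cycle of length at least 4 gets a state: the states
  around the cycle read \<open>0 1 2 3 4 3 4 \<dots> 3 4\<close> if its length is odd and \<open>4 3 4 3 \<dots> 4 3\<close> if it
  is even; the triangle gets \<open>0 1 2\<close>. The colour of \<open>(i, j)\<close> is looked up in a fixed table at the
  states of \<open>i\<close> and \<open>j\<close>. Whether this is a lid-colouring depends only on the windows of four
  consecutive states, of which there are finitely many.
\<close>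

section \<open>Neighbourhoods in the torus\<close>

text \<open>Written by cases instead of with \<open>mod\<close>, so that facts about successors
  reduce to linear arithmetic.\<close>

definition cnext :: "nat \<Rightarrow> nat \<Rightarrow> nat" where
  "cnext m i = (if Suc i = m then 0 else Suc i)"

definition cprev :: "nat \<Rightarrow> nat \<Rightarrow> nat" where
  "cprev m i = (if i = 0 then m - 1 else i - 1)"

lemma cnext_less: "i < m \<Longrightarrow> cnext m i < m"
  and cprev_less: "i < m \<Longrightarrow> cprev m i < m"
  and cprev_cnext: "i < m \<Longrightarrow> cprev m (cnext m i) = i"
  and cnext_cprev: "i < m \<Longrightarrow> cnext m (cprev m i) = i"
  by (auto simp: cnext_def cprev_def)

lemma cnext_neq: "2 \<le> m \<Longrightarrow> cnext m i \<noteq> i"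
  by (auto simp: cnext_def)

lemma verts_cycle_graph: "verts (cycle_graph m) = {..<m}"
  by (simp add: cycle_graph_def)

lemma adj_cycle_graph_iff:
  "adj (cycle_graph m) i j \<longleftrightarrow> i < m \<and> (j = cnext m i \<or> j = cprev m i)"
proof -
  have "(k + 1) mod m = cnext m k" if "k < m" for k
    using that by (auto simp: cnext_def)
  then have "adj (cycle_graph m) i j \<longleftrightarrow>
      i < m \<and> j < m \<and> (j = cnext m i \<or> i = cnext m j)"
    by (auto simp: cycle_graph_def)
  also have "\<dots> \<longleftrightarrow> i < m \<and> (j = cnext m i \<or> j = cprev m i)"
    using cnext_less cprev_less cprev_cnext cnext_cprev by metis
  finally show ?thesis .
qed

abbreviation torus :: "nat \<Rightarrow> nat \<Rightarrow> (nat \<times> nat) ugraph" where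
  "torus m n \<equiv> cycle_graph m \<box> cycle_graph n"

lemma verts_torus: "verts (torus m n) = {..<m} \<times> {..<n}"
  by (simp add: cartesian_product_def verts_cycle_graph)

lemma adj_torus_iff:
  "adj (torus m n) (i, j) v \<longleftrightarrow> i < m \<and> j < n \<and>
     v \<in> {(cnext m i, j), (cprev m i, j), (i, cnext n j), (i, cprev n j)}"
  by (cases v) (auto simp: cartesian_product_def adj_cycle_graph_iff verts_cycle_graph)

lemma closed_nbhd_torus:
  "i < m \<Longrightarrow> j < n \<Longrightarrow> closed_nbhd (torus m n) (i, j) =
     {(i, j), (cprev m i, j), (cnext m i, j), (i, cprev n j), (i, cnext n j)}"
  by (auto simp: closed_nbhd_def adj_torus_iff)

lemma simple_graph_torus: "2 \<le> m \<Longrightarrow> 2 \<le> n \<Longrightarrow> simple_graph (torus m n)"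
  by (simp add: simple_graph_cycle_graph simple_graph_cartesian_product)

text \<open>An edge to a predecessor is an edge to a successor read backwards, so a symmetric
  property need only be checked on the two kinds of forward edges.\<close>

lemma torus_adj_induct [consumes 1, case_names sym fst snd]:
  assumes "adj (torus m n) u v"
    and "\<And>u v. P u v \<Longrightarrow> P v u"
    and "\<And>i j. i < m \<Longrightarrow> j < n \<Longrightarrow> P (i, j) (cnext m i, j)"
    and "\<And>i j. i < m \<Longrightarrow> j < n \<Longrightarrow> P (i, j) (i, cnext n j)"
  shows "P u v"
proof -
  obtain i j where u: "u = (i, j)" by fastforce
  have ij: "i < m" "j < n"
    using assms(1) unfolding u adj_torus_iff by auto
  have "P (cprev m i, j) (i, j)" "P (i, cprev n j) (i, j)"
    using assms(3)[of "cprev m i" j] assms(4)[of i "cprev n j"] ij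
    by (simp_all add: cprev_less cnext_cprev)
  then show ?thesis
    using assms(1-4) ij unfolding u adj_torus_iff by blast
qed

text \<open>A neighbour of one end in the direction across the edge differs from the other end in
  both coordinates, hence is not adjacent to it. So the lid condition applies to every edge of the
  torus.\<close>

lemma closed_nbhd_torus_neq:
  assumes "adj (torus m n) u v" and "3 \<le> m" and "3 \<le> n"
  shows "closed_nbhd (torus m n) u \<noteq> closed_nbhd (torus m n) v"
  using assms(1)
proof (induction rule: torus_adj_induct)
  case (fst i j)
  have "(i, cnext n j) \<notin> closed_nbhd (torus m n) (cnext m i, j)"
    using fst assms cnext_neq[of n j] cnext_neq[of m i]
    by (auto simp: closed_nbhd_torus cnext_less)
  then show ?case using fst by (auto simp: closed_nbhd_torus)
next
  case (snd i j)
  have "(cnext m i, j) \<notin> closed_nbhd (torus m n) (i, cnext n j)"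
    using snd assms cnext_neq[of n j] cnext_neq[of m i]
    by (auto simp: closed_nbhd_torus cnext_less)
  then show ?case using snd by (auto simp: closed_nbhd_torus)
qed auto

section \<open>Lower bounds\<close>

lemma lid_coloring_image_closed_nbhd:
  assumes "simple_graph G" and "lid_coloring G k f" and "adj G u v"
  shows "f ` closed_nbhd G u \<subseteq> {1..k}" and "{f u, f v} \<subseteq> f ` closed_nbhd G u"
    and "f u \<noteq> f v"
  using assms
  by (auto simp: lid_coloring_def proper_coloring_def simple_graph_def closed_nbhd_def
      image_subset_iff)

text \<open>With at most two colours, both colour sets are squeezed between the pair
  \<open>{f u, f v}\<close> and \<open>{1..k}\<close>, hence coincide.\<close>

lemma lid_coloring_ge_3:
  assumes G: "simple_graph G" and f: "lid_coloring G k f" and uv: "adj G u v"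
    and "closed_nbhd G u \<noteq> closed_nbhd G v"
  shows "3 \<le> k"
proof (rule ccontr)
  assume k: "\<not> 3 \<le> k"
  have vu: "adj G v u" using G uv unfolding simple_graph_def by blast
  note U = lid_coloring_image_closed_nbhd[OF G f uv]
  note V = lid_coloring_image_closed_nbhd[OF G f vu]
  have eq: "{f u, f v} = {1..k}"
    by (rule card_seteq[OF _ subset_trans[OF U(2,1)]]) (use U(3) k in auto)
  have "f ` closed_nbhd G u = f ` closed_nbhd G v"
    using subset_antisym[OF U(1) U(2)[unfolded eq]]
      subset_antisym[OF V(1) V(2)[unfolded insert_commute[of "f v"] eq]] by (rule trans[OF _ sym])
  then show False using f uv assms(4) by (simp add: lid_coloring_def)
qed

lemma lid_3_coloring_full_neq:
  assumes G: "simple_graph G" and f: "lid_coloring G 3 f" and uv: "adj G u v"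
    and "closed_nbhd G u \<noteq> closed_nbhd G v"
  shows "(f ` closed_nbhd G u = {1..3}) \<noteq> (f ` closed_nbhd G v = {1..3})"
proof -
  have vu: "adj G v u" using G uv unfolding simple_graph_def by blast
  note U = lid_coloring_image_closed_nbhd[OF G f uv]
  note V = lid_coloring_image_closed_nbhd[OF G f vu]
  have *: "S = {1..3} \<or> S = {f u, f v}" if "{f u, f v} \<subseteq> S" "S \<subseteq> {1..3}" for S
  proof (rule disjCI)
    assume "S \<noteq> {f u, f v}"
    then have "card {f u, f v} < card S"
      using that by (intro psubset_card_mono) (auto intro: finite_subset)
    then show "S = {1..3}"
      using that U(3) by (intro card_seteq) auto
  qed
  have "f ` closed_nbhd G u \<noteq> f ` closed_nbhd G v"
    using f uv assms(4) by (auto simp: lid_coloring_def)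
  then show ?thesis
    using *[OF U(2,1)] *[OF V(2)[unfolded insert_commute[of "f v"]] V(1)] by metis
qed

text \<open>Along the path from 0 to \<open>m - 1\<close> the value depends only on the parity of
  \<open>i\<close>; the closing edge then forces \<open>m - 1\<close> to be odd.\<close>

lemma alternating_cycle_even:
  fixes P :: "nat \<Rightarrow> bool"
  assumes "0 < m" and alt: "\<And>i. i < m \<Longrightarrow> P i \<noteq> P (cnext m i)"
  shows "even m"
proof -
  have *: "i < m \<Longrightarrow> P i = (P 0 = even i)" for i
  proof (induction i)
    case (Suc i)
    then show ?case using alt[of i] by (auto simp: cnext_def)
  qed simp
  have "P 0 \<noteq> P (m - 1)"
    using alt[of "m - 1"] assms(1) by (simp add: cnext_def)
  then show ?thesis using *[of "m - 1"] assms(1) by auto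
qed

lemma lid_3_coloring_torus_even:
  assumes "3 \<le> m" and "3 \<le> n" and f: "lid_coloring (torus m n) 3 f"
  shows "even m \<and> even n"
proof -
  define T where "T v \<longleftrightarrow> f ` closed_nbhd (torus m n) v = {1..3}" for v
  have T: "T u \<noteq> T v" if "adj (torus m n) u v" for u v
    unfolding T_def using that assms
    by (intro lid_3_coloring_full_neq simple_graph_torus closed_nbhd_torus_neq) auto
  \<comment> \<open>The vertices \<open>(i, 0)\<close> form a copy of the first cycle, and
    \<open>T\<close> alternates along it.\<close>
  have "even m"
    by (rule alternating_cycle_even[where P = "\<lambda>i. T (i, 0)"])
      (use assms in \<open>auto intro!: T simp: adj_torus_iff simp del: not_iff\<close>)
  moreover have "even n"
    by (rule alternating_cycle_even[where P = "\<lambda>j. T (0, j)"])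
      (use assms in \<open>auto intro!: T simp: adj_torus_iff simp del: not_iff\<close>)
  ultimately show ?thesis ..
qed

lemma lid_coloring_triangle_ge_5:
  assumes G: "simple_graph G" and f: "lid_coloring G k f"
    and adj: "adj G u v" "adj G v w" "adj G w u"
    and neq: "closed_nbhd G u \<noteq> closed_nbhd G v" "closed_nbhd G v \<noteq> closed_nbhd G w"
      "closed_nbhd G w \<noteq> closed_nbhd G u"
  shows "5 \<le> k"
proof -
  have adj': "adj G v u" "adj G w v" "adj G u w"
    using G adj unfolding simple_graph_def by blast+
  define T where "T = {f u, f v, f w}"
  define D where "D = {1..k} - T"
  define S where "S x = f ` closed_nbhd G x" for x
  note lid = lid_coloring_image_closed_nbhd[OF G f]
  have ge: "T \<subseteq> S u" "T \<subseteq> S v" "T \<subseteq> S w"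
    using adj[THEN lid(2)] adj'[THEN lid(2)] by (simp_all add: T_def S_def)
  have le: "S u \<subseteq> {1..k}" "S v \<subseteq> {1..k}" "S w \<subseteq> {1..k}"
    unfolding S_def by (rule adj[THEN lid(1)])+
  have "S u \<noteq> S v" "S v \<noteq> S w" "S w \<noteq> S u"
    using f adj neq by (simp_all add: lid_coloring_def S_def)
  \<comment> \<open>All three colour sets contain \<open>T\<close>, so they stay distinct when
    \<open>T\<close> is removed and become three different subsets of the spare colours
    \<open>D\<close>.\<close>
  moreover have "A = B" if "T \<subseteq> A" "T \<subseteq> B" "A - T = B - T" for A B
    using that by blast
  ultimately have "card {S u - T, S v - T, S w - T} = 3"
    using ge by (metis card_3_iff)
  moreover have "card {S u - T, S v - T, S w - T} \<le> card (Pow D)"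
    using le by (intro card_mono) (auto simp: D_def)
  ultimately have "3 \<le> (2::nat) ^ card D"
    by (simp add: card_Pow D_def)
  \<comment> \<open>A single spare colour would leave room for only two subsets.\<close>
  moreover have "(2::nat) ^ card D \<le> 2 ^ 1" if "card D \<le> 1"
    using that by (intro power_increasing) auto
  ultimately have "2 \<le> card D" by fastforce
  moreover have "card T = 3"
    using lid(3)[OF adj(1)] lid(3)[OF adj(2)] lid(3)[OF adj(3)] by (auto simp: T_def)
  moreover have "card D = k - card T"
    using subset_trans[OF ge(1) le(1)] by (simp add: D_def card_Diff_subset T_def)
  ultimately show ?thesis by simp
qed

section \<open>Colourings from tables\<close>

text \<open>The colours around a vertex with states \<open>b\<close> and \<open>q\<close>, where
  \<open>a\<close>, \<open>c\<close> and \<open>p\<close>, \<open>r\<close> are the states before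
  and after in the two directions.\<close>

definition star :: "(nat \<Rightarrow> nat \<Rightarrow> nat) \<Rightarrow> nat \<times> nat \<times> nat \<Rightarrow> nat \<times> nat \<times> nat \<Rightarrow> nat set" where
  "star F = (\<lambda>(a, b, c) (p, q, r). {F b q, F a q, F c q, F b p, F b r})"

text \<open>Only forward edges are tested. Comparing a vertex with its successor involves the states
  from one place before to two places after it, hence windows of length four.\<close>

definition table_ok ::
  "nat \<Rightarrow> (nat \<Rightarrow> nat \<Rightarrow> nat) \<Rightarrow> (nat \<times> nat \<times> nat \<times> nat) list \<Rightarrow> (nat \<times> nat \<times> nat \<times> nat) list \<Rightarrow> bool"
  where
  "table_ok k F R C \<longleftrightarrow> (\<forall>(a, b, c, d) \<in> set R. \<forall>(p, q, r, s) \<in> set C.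
     1 \<le> F b q \<and> F b q \<le> k \<and> F b q \<noteq> F c q \<and> F b q \<noteq> F b r \<and>
     star F (a, b, c) (p, q, r) \<noteq> star F (b, c, d) (p, q, r) \<and>
     star F (a, b, c) (p, q, r) \<noteq> star F (a, b, c) (q, r, s))"

definition window :: "nat \<Rightarrow> (nat \<Rightarrow> nat) \<Rightarrow> nat \<Rightarrow> nat \<times> nat \<times> nat \<times> nat" where
  "window m s i = (s (cprev m i), s i, s (cnext m i), s (cnext m (cnext m i)))"

lemma lid_coloring_table:
  assumes ok: "table_ok k F R C"
    and R: "\<And>i. i < m \<Longrightarrow> window m s i \<in> set R"
    and C: "\<And>j. j < n \<Longrightarrow> window n t j \<in> set C"
  shows "lid_coloring (torus m n) k (\<lambda>(i, j). F (s i) (t j))" (is "lid_coloring _ _ ?f")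
proof -
  have ok: "1 \<le> F (s i) (t j) \<and> F (s i) (t j) \<le> k \<and>
      F (s i) (t j) \<noteq> F (s (cnext m i)) (t j) \<and> F (s i) (t j) \<noteq> F (s i) (t (cnext n j)) \<and>
      ?f ` closed_nbhd (torus m n) (i, j) \<noteq> ?f ` closed_nbhd (torus m n) (cnext m i, j) \<and>
      ?f ` closed_nbhd (torus m n) (i, j) \<noteq> ?f ` closed_nbhd (torus m n) (i, cnext n j)"
    if "i < m" "j < n" for i j
    \<comment> \<open>By \<open>cprev_cnext\<close>, the last three entries of a window are the
      states around the successor, so the shifted stars are the colour sets at the
      successors.\<close>
    using ok[unfolded table_ok_def, rule_format, OF R[OF that(1)], unfolded window_def,
        simplified, rule_format, OF C[OF that(2), unfolded window_def]] that
    by (simp add: closed_nbhd_torus cnext_less cprev_cnext star_def)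
  have "?f u \<noteq> ?f v \<and> ?f ` closed_nbhd (torus m n) u \<noteq> ?f ` closed_nbhd (torus m n) v"
    if "adj (torus m n) u v" for u v
    using that
  proof (induction rule: torus_adj_induct)
    case (sym u v)
    then show ?case by metis
  qed (use ok in auto)
  then show ?thesis
    unfolding lid_coloring_def proper_coloring_def verts_torus using ok by auto
qed

definition state :: "nat \<Rightarrow> nat \<Rightarrow> nat" where
  "state m i = (if odd m \<and> i < 3 then i else 4 - i mod 2)"

definition even_windows :: "(nat \<times> nat \<times> nat \<times> nat) list" where
  "even_windows = [(3,4,3,4), (4,3,4,3)]"

text \<open>The added windows are those that meet the block 0 1 2 of an odd cycle;
  \<open>(2,3,4,0)\<close> meets it at both ends and arises only for length 5.\<close>

definition windows :: "(nat \<times> nat \<times> nat \<times> nat) list" where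
  "windows = even_windows @
     [(0,1,2,3), (1,2,3,4), (2,3,4,0), (2,3,4,3), (3,4,0,1), (4,0,1,2), (4,3,4,0)]"

definition triangle_windows :: "(nat \<times> nat \<times> nat \<times> nat) list" where
  "triangle_windows = [(0,1,2,0), (1,2,0,1), (2,0,1,2)]"

lemma window_state_even:
  assumes "even m" and "i < m"
  shows "window m (state m) i \<in> set even_windows"
  using assms
  by (auto simp: window_def state_def even_windows_def cnext_def cprev_def mod2_eq_if
      intro: odd_pos)

lemma window_state_triangle:
  assumes "i < 3"
  shows "window 3 (state 3) i \<in> set triangle_windows"
proof -
  have "i = 0 \<or> i = 1 \<or> i = 2" using assms by auto
  then show ?thesis
    by (auto simp: window_def state_def triangle_windows_def cnext_def cprev_def)
qed

lemma window_state:
  assumes "4 \<le> m" and "i < m"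
  shows "window m (state m) i \<in> set windows"
proof (cases "even m")
  case True
  then show ?thesis using window_state_even assms by (simp add: windows_def)
next
  case False
  consider "i = 0" | "i = 1" | "i = 2" | "i = 3" | "4 \<le> i" by linarith
  then show ?thesis
    using assms False
    by cases (auto simp: window_def state_def windows_def even_windows_def cnext_def cprev_def
        mod2_eq_if)
qed

text \<open>The tables for four and five colours were found with a SAT solver.\<close>

definition table3 :: "nat \<Rightarrow> nat \<Rightarrow> nat" where
  "table3 a b = (if a = b then a - 2 else 3)"

definition table4 :: "nat \<Rightarrow> nat \<Rightarrow> nat" where
  "table4 a b = [[2,4,3,2,4], [4,1,2,3,1], [3,2,4,2,4], [2,1,2,4,3], [4,3,4,1,2]] ! a ! b"

definition table5 :: "nat \<Rightarrow> nat \<Rightarrow> nat" where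
  "table5 a b = [[5,3,4,1,3], [3,4,2,3,5], [1,5,3,4,2]] ! a ! b"

text \<open>Equal states give colour 1 or 2 with all neighbours coloured 3; unequal states give
  colour 3 with neighbours of both colours 1 and 2. Colour sets of sizes two and three thus
  alternate.\<close>

lemma table3_ok: "table_ok 3 table3 even_windows even_windows"
  by code_simp

lemma table4_ok: "table_ok 4 table4 windows windows"
  by code_simp

text \<open>The second cycle may also be a triangle, hence the longer list of column
  windows.\<close>

lemma table5_ok: "table_ok 5 table5 triangle_windows (triangle_windows @ windows)"
  by code_simp

lemma chi_lid_eqI:
  assumes "lid_coloring G k f" and "\<And>l g. lid_coloring G l g \<Longrightarrow> k \<le> l"
  shows "chi_lid G = k"
  unfolding chi_lid_def using assms by (intro Least_equality) auto

theorem theorem6: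
  fixes m n :: nat
  assumes "3 \<le> m" and "m \<le> n"
  shows "chi_lid (cycle_graph m \<box> cycle_graph n) =
    (if m = 3 then 5
     else if even m \<and> even n then 3
     else 4)"
proof -
  note G = simple_graph_torus[of m n]
  have adj: "adj (torus m n) (0, 0) (cnext m 0, 0)"
    using assms by (auto simp: adj_torus_iff)
  have ge_3: "3 \<le> k" if "lid_coloring (torus m n) k f" for k f
    using lid_coloring_ge_3[OF _ that adj] closed_nbhd_torus_neq[OF adj] G assms by simp
  consider "m = 3" | "4 \<le> m" "even m" "even n" | "4 \<le> m" "\<not> (even m \<and> even n)"
    using assms by fastforce
  then show ?thesis
  proof cases
    case 1
    have win: "window n (state n) j \<in> set (triangle_windows @ windows)" if "j < n" for j
      using that assms 1 window_state[of n j] window_state_triangle[of j]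
      by (cases "n = 3") auto
    have "chi_lid (torus m n) = 5"
    proof (rule chi_lid_eqI)
      show "lid_coloring (torus m n) 5 (\<lambda>(i, j). table5 (state m i) (state n j))"
        using lid_coloring_table[OF table5_ok] window_state_triangle win 1 by blast
    next
      fix k f assume f: "lid_coloring (torus m n) k f"
      \<comment> \<open>For \<open>m = 3\<close> each copy of the first cycle is a triangle.\<close>
      have tri: "adj (torus m n) (0, 0) (1, 0)" "adj (torus m n) (1, 0) (2, 0)"
        "adj (torus m n) (2, 0) (0, 0)"
        using 1 assms by (auto simp: adj_torus_iff cnext_def)
      show "5 \<le> k"
        using lid_coloring_triangle_ge_5[OF _ f tri] tri[THEN closed_nbhd_torus_neq] G assms
        by simp
    qed
    then show ?thesis using 1 by simp
  next
    case 2
    have "chi_lid (torus m n) = 3"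
      using lid_coloring_table[OF table3_ok] window_state_even 2 ge_3
      by (intro chi_lid_eqI) blast+
    then show ?thesis using 2 by simp
  next
    case 3
    have "chi_lid (torus m n) = 4"
    proof (rule chi_lid_eqI)
      show "lid_coloring (torus m n) 4 (\<lambda>(i, j). table4 (state m i) (state n j))"
        using assms 3 by (intro lid_coloring_table[OF table4_ok] window_state) auto
    next
      fix k f assume f: "lid_coloring (torus m n) k f"
      \<comment> \<open>Three colours would make both lengths even, which this case
        excludes.\<close>
      have "k \<noteq> 3" using lid_3_coloring_torus_even[of m n f] f assms 3 by auto
      then show "4 \<le> k" using ge_3[OF f] by simp
    qed
    then show ?thesis using 3 by auto
  qed
qed

end
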